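(* Suppose that $0\le\theta<\frac{\pi}{2}$ and let $D_\theta := \{re^{i\alpha} : r\ge 0 \text{ and } |\alpha|\le\theta\}$. Let $f:\mathbb{C}\to\mathbb{C}$ be holomorphic in a domain containing $D_\theta$ (so that in particular $f$ is holomorphic at the origin), and assume that $f$ and all of its derivatives are of sufficient decay in $D_\theta$. Then for $a\in\mathbb{R}$ and $N\in\mathbb{N}_0$, $$\sum_{m\ge 0} f(w(m+a)) = \frac1w\int_0^\infty f(x)\,dx - \sum_{n=0}^{N-1}\frac{B_{n+1}(a) f^{(n)}(0)}{(n+1)!}w^n + O_N(w^N),$$ uniformly, as $w\to 0$ in $D_\theta$.
   Context: A function $g$ is of sufficient decay in a domain $D\subset\mathbb{C}$ if there exists some $\varepsilon>0$ such that $g(w)\ll |w|^{-1-\varepsilon}$ as $|w|\to\infty$ in $D$ (the $\varepsilon$ may be different for different derivatives of $f$). The Bernoulli polynomials $B_n(x)$ are defined by $\sum_{n\ge0}B_n(x)\frac{t^n}{n!}=\frac{te^{tx}}{e^t-1}$. $\mathbb{N}_0=\{0,1,2,\dots\}$. The limit is over $w\in D_\theta\setminus\{0\}$, and the $O_N$-constant may depend on $f,a,\theta,N$ but not on $w$. *)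

theory Defs
  imports "HOL-Complex_Analysis.Complex_Analysis" "HOL-Library.Landau_Symbols"
begin

definition sector :: "real \<Rightarrow> complex set" where
  "sector \<theta> = {of_real r * exp (\<i> * of_real \<alpha>) | r \<alpha>. 0 \<le> r \<and> \<bar>\<alpha>\<bar> \<le> \<theta>}"

text \<open>
  The exponent \<open>\<epsilon>\<close> is existentially bound for each function separately, so it may
  differ between a function and its derivatives.
\<close>

definition sufficient_decay :: "(complex \<Rightarrow> complex) \<Rightarrow> complex set \<Rightarrow> bool" where
  "sufficient_decay g D \<longleftrightarrow>
     (\<exists>\<epsilon>>0. (\<lambda>w. norm (g w)) \<in> O[inf at_infinity (principal D)](\<lambda>w. norm w powr (- 1 - \<epsilon>)))"

text \<open>
  The division is division of formal power series in \<open>t\<close>; both series have zero constant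
  term, and the lemma below confirms that the quotient is the intended one.
\<close>

definition bernoulli_poly :: "nat \<Rightarrow> 'a::field_char_0 \<Rightarrow> 'a" where
  "bernoulli_poly n x = fact n * fps_nth (fps_X * fps_exp x / (fps_exp 1 - 1)) n"

lemma bernoulli_poly_generating_function:
  fixes x :: "'a::field_char_0"
  shows "Abs_fps (\<lambda>n. bernoulli_poly n x / fact n) * (fps_exp 1 - 1) = fps_X * fps_exp x"
proof -
  have eq: "Abs_fps (\<lambda>n. bernoulli_poly n x / fact n) = fps_X * fps_exp x / (fps_exp 1 - 1)"
    by (rule fps_ext) (simp add: bernoulli_poly_def)
  have sub: "subdegree (fps_exp (1::'a) - 1) = 1"
    by (rule subdegreeI) auto
  then have nz: "fps_exp (1::'a) - 1 \<noteq> 0"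
    by auto
  have nz': "fps_X * fps_exp x \<noteq> 0"
    by simp
  have "subdegree (fps_X * fps_exp x) = 1"
    by (rule subdegreeI) auto
  then have "fps_exp 1 - 1 dvd fps_X * fps_exp x"
    using fps_dvd_iff[OF nz nz'] sub by simp
  then show ?thesis
    unfolding eq by simp
qed

end

theory Submission
  imports Defs "HOL-Real_Asymp.Real_Asymp"
begin

text \<open>
  The expansion is the Euler--Maclaurin formula on the ray through \<open>w\<close>. Let \<open>F\<close> be a primitive of \<open>f\<close>
  near the sector with \<open>F 0 = 0\<close>, and put
  \<open>E z = (\<Sum>n\<le>N+1. B\<^sub>n(a) / n! * w\<^sup>n * \<partial>\<^sup>n F z) / w\<close>. By the generating function of the Bernoulli
  polynomials, \<open>E (z + w) - E z\<close> agrees with \<open>f (z + w a)\<close> up to Taylor remainders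
  (\<open>Euler_Maclaurin_step\<close>), which are bounded by \<open>norm w ^ (N + 1)\<close> times a bound for the derivative of
  \<open>f\<close> of order \<open>N + 1\<close> near \<open>z\<close>.

  Summation over \<open>z = w m\<close> telescopes (\<open>Euler_Maclaurin_ray\<close>). At infinity all derivatives
  of \<open>F\<close> of positive order tend to \<open>0\<close>, while \<open>F\<close> itself tends to the integral of \<open>f\<close> over the positive
  axis, whatever the direction of the ray (\<open>decaying_primitive_ray_limit\<close>). This gives the main term;
  \<open>E 0\<close> gives the finite expansion, with one term more than required. By the decay of the derivative
  of \<open>f\<close> of order \<open>N + 1\<close>, the sum of its bounds is of the order \<open>1 / norm w\<close>
  (\<open>powr_kernel_sum\<close>), so the total error is of the order \<open>w ^ N\<close>, and so is the surplus term. The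
  constants come from decay bounds that hold on the whole sector, whence the uniformity in \<open>w\<close>.
\<close>

section \<open>Geometry of the sector\<close>

text \<open>
  The angular condition is an inequality between a convex function of \<open>z\<close> and a linear one,
  because the cosine is decreasing on \<open>[0, \<pi>]\<close>. In this form the geometry of the sector (closed,
  convex, a cone) is evident, and the case \<open>\<theta> = 0\<close> is no exception.
\<close>

lemma sector_eq:
  assumes "0 \<le> \<theta>" "\<theta> < pi / 2"
  shows "sector \<theta> = {z. norm z * cos \<theta> \<le> Re z}"
proof (intro equalityI subsetI CollectI)
  fix z assume "z \<in> sector \<theta>"
  then obtain r \<alpha> where z: "z = of_real r * exp (\<i> * of_real \<alpha>)" and r: "0 \<le> r" and \<alpha>: "\<bar>\<alpha>\<bar> \<le> \<theta>"
    unfolding sector_def by blast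
  have "cos \<theta> \<le> cos \<bar>\<alpha>\<bar>"
    using \<alpha> assms by (intro cos_monotone_0_pi_le) auto
  then show "norm z * cos \<theta> \<le> Re z"
    using r by (simp add: z norm_mult Re_exp mult_left_mono)
next
  fix z assume "z \<in> {z. norm z * cos \<theta> \<le> Re z}"
  then have z: "norm z * cos \<theta> \<le> Re z" by simp
  show "z \<in> sector \<theta>"
  proof (cases "z = 0")
    case True
    then show ?thesis
      unfolding sector_def using assms by (auto intro!: exI[of _ 0])
  next
    case False
    have "cos \<theta> \<le> cos \<bar>Arg z\<bar>"
      using z False by (simp add: cos_Arg field_simps)
    then have "\<bar>Arg z\<bar> \<le> \<theta>"
      using Arg_bounded[of z] assms by (subst (asm) cos_mono_le_eq) auto
    then show ?thesis
      using Arg_eq[OF False] norm_ge_zero[of z] unfolding sector_def by blast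
  qed
qed

lemma sector_scale:
  assumes "0 \<le> \<theta>" "\<theta> < pi / 2" "z \<in> sector \<theta>" "0 \<le> s"
  shows "z * of_real s \<in> sector \<theta>"
  using assms(3,4) unfolding sector_eq[OF assms(1,2)]
  by (auto simp: norm_mult mult.commute[of _ s] mult.assoc mult_left_mono)

lemma of_real_in_sector:
  assumes "0 \<le> \<theta>" "\<theta> < pi / 2" "0 \<le> s"
  shows "of_real s \<in> sector \<theta>"
  using assms(3) unfolding sector_eq[OF assms(1,2)] by (simp add: mult_left_le)

lemma closed_sector:
  assumes "0 \<le> \<theta>" "\<theta> < pi / 2"
  shows "closed (sector \<theta>)"
  unfolding sector_eq[OF assms] by (intro closed_Collect_le continuous_intros)

lemma convex_sector:
  assumes "0 \<le> \<theta>" "\<theta> < pi / 2"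
  shows "convex (sector \<theta>)"
proof (rule convexI)
  fix x y :: complex and u v :: real
  assume xy: "x \<in> sector \<theta>" "y \<in> sector \<theta>" and uv: "0 \<le> u" "0 \<le> v" "u + v = 1"
  have c: "0 \<le> cos \<theta>"
    using assms by (intro cos_ge_zero) auto
  have "norm (u *\<^sub>R x + v *\<^sub>R y) * cos \<theta> \<le> (u * norm x + v * norm y) * cos \<theta>"
    using uv by (intro mult_right_mono c norm_triangle_le) auto
  also have "\<dots> = u * (norm x * cos \<theta>) + v * (norm y * cos \<theta>)"
    by (simp add: algebra_simps)
  also have "\<dots> \<le> u * Re x + v * Re y"
    using xy uv unfolding sector_eq[OF assms] by (intro add_mono mult_left_mono) auto
  finally show "u *\<^sub>R x + v *\<^sub>R y \<in> sector \<theta>"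
    unfolding sector_eq[OF assms] by simp
qed

section \<open>The local Euler--Maclaurin formula\<close>

text \<open>
  This compares the coefficients of \<open>t ^ Suc k\<close> in the generating function after multiplication
  by \<open>e\<^sup>t - 1\<close>.
\<close>

lemma bernoulli_poly_recurrence:
  fixes a :: "'a::field_char_0"
  shows "(\<Sum>i\<le>k. bernoulli_poly i a / (fact i * fact (Suc (k - i)))) = a ^ k / fact k"
proof -
  have "fps_nth (Abs_fps (\<lambda>n. bernoulli_poly n a / fact n) * (fps_exp 1 - 1)) (Suc k) = a ^ k / fact k"
    unfolding bernoulli_poly_generating_function by (simp add: fps_exp_def)
  then have "a ^ k / fact k = (\<Sum>i=0..Suc k. bernoulli_poly i a / fact i * fps_nth (fps_exp 1 - 1) (Suc k - i))"
    by (simp add: fps_mult_nth)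
  also have "\<dots> = (\<Sum>i\<le>k. bernoulli_poly i a / fact i * fps_nth (fps_exp 1 - 1) (Suc k - i))"
    by (simp add: atLeast0AtMost mult.commute)
  also have "\<dots> = (\<Sum>i\<le>k. bernoulli_poly i a / (fact i * fact (Suc (k - i))))"
    by (intro sum.cong refl) (simp add: Suc_diff_le mult.commute del: fact_Suc)
  finally show ?thesis by (rule sym)
qed

lemma bernoulli_poly_0 [simp]: "bernoulli_poly 0 (a :: 'a::field_char_0) = 1"
  using bernoulli_poly_recurrence[where k = 0 and a = a] by simp

text \<open>
  Here \<open>D i\<close> stands for the \<open>i\<close>-th derivative of \<open>D 0\<close>. With \<open>\<partial>\<close> for differentiation, the
  difference under the norm is the error in the truncation of the operator identity
  \<open>(w\<partial> e\<^bsup>aw\<partial>\<^esup> / (e\<^bsup>w\<partial>\<^esup> - 1)) (e\<^bsup>w\<partial>\<^esup> - 1) = w\<partial> e\<^bsup>aw\<partial>\<^esup>\<close> at order \<open>Suc M\<close>: the first factor is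
  the generating function of the Bernoulli polynomials, and \<open>e\<^bsup>w\<partial>\<^esup>\<close> is translation by \<open>w\<close>. Replacing every translate by its
  Taylor polynomial of the same total order, the polynomials cancel exactly and only Taylor
  remainders are left.
\<close>

lemma Euler_Maclaurin_step:
  fixes D :: "nat \<Rightarrow> complex \<Rightarrow> complex" and a :: real
  assumes K: "convex K" "z \<in> K" "z + w \<in> K" "z + w * of_real a \<in> K"
    and D: "\<And>i x. x \<in> K \<Longrightarrow> i \<le> Suc M \<Longrightarrow> (D i has_field_derivative D (Suc i) x) (at x within K)"
    and B: "\<And>x. x \<in> K \<Longrightarrow> norm (D (Suc (Suc M)) x) \<le> B"
  shows "norm ((\<Sum>n\<le>Suc M. of_real (bernoulli_poly n a / fact n) * w ^ n * (D n (z + w) - D n z))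
                 - w * D 1 (z + w * of_real a))
         \<le> B * norm w ^ Suc (Suc M) * ((\<Sum>n\<le>Suc M. \<bar>bernoulli_poly n a / fact n\<bar>) + \<bar>a\<bar> ^ Suc M)"
proof -
  define \<beta> where "\<beta> n = (of_real (bernoulli_poly n a / fact n) :: complex)" for n
  have B0: "0 \<le> B"
    using B[OF K(2)] norm_ge_zero order_trans by blast
  have div_fact: "x / fact k \<le> x" if "0 \<le> x" for x :: real and k
    using that fact_ge_1[of k, where 'a = real] by (simp add: divide_le_eq mult_le_cancel_left1)
  define R where "R n = D n (z + w) - D n z - (\<Sum>j<Suc M - n. D (n + Suc j) z * w ^ Suc j / fact (Suc j))" for n
  define R' where "R' = D 1 (z + w * of_real a) - (\<Sum>k<Suc M. D (Suc k) z * (w * of_real a) ^ k / fact k)"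
  have R: "norm (R n) \<le> B * norm w ^ Suc (Suc M - n)" if "n \<le> Suc M" for n
  proof -
    have "norm (D (n + 0) (z + w) - (\<Sum>i\<le>Suc M - n. D (n + i) z * (z + w - z) ^ i / fact i))
          \<le> B * norm (z + w - z) ^ Suc (Suc M - n) / fact (Suc M - n)"
      by (rule complex_Taylor[where f = "\<lambda>i. D (n + i)" and S = K])
         (use K D[of _ "n + i" for i] B that in \<open>auto simp: Suc_diff_le\<close>)
    also have "\<dots> \<le> B * norm w ^ Suc (Suc M - n)"
      using B0 by (simp add: div_fact)
    also have "(\<Sum>i\<le>Suc M - n. D (n + i) z * (z + w - z) ^ i / fact i)
        = D n z + (\<Sum>j<Suc M - n. D (n + Suc j) z * w ^ Suc j / fact (Suc j))"
      by (simp only: lessThan_Suc_atMost[symmetric] sum.lessThan_Suc_shift) simp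
    finally show ?thesis
      by (simp only: R_def diff_diff_eq add_0_right)
  qed
  have R': "norm R' \<le> B * (norm w * \<bar>a\<bar>) ^ Suc M"
  proof -
    have "norm (D (Suc 0) (z + w * of_real a) - (\<Sum>i\<le>M. D (Suc i) z * (z + w * of_real a - z) ^ i / fact i))
          \<le> B * norm (z + w * of_real a - z) ^ Suc M / fact M"
      by (rule complex_Taylor[where f = "\<lambda>i. D (Suc i)" and S = K]) (use K D B in auto)
    also have "\<dots> \<le> B * (norm w * \<bar>a\<bar>) ^ Suc M"
      using B0 by (simp add: norm_mult div_fact)
    finally show ?thesis
      by (simp add: R'_def lessThan_Suc_atMost)
  qed
  \<comment> \<open>The sum runs over a triangle; along its diagonals the recurrence for the Bernoulli
      polynomials collects the coefficients.\<close>
  have main: "(\<Sum>n\<le>Suc M. \<beta> n * w ^ n * (\<Sum>j<Suc M - n. D (n + Suc j) z * w ^ Suc j / fact (Suc j)))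
      = w * (\<Sum>k<Suc M. D (Suc k) z * (w * of_real a) ^ k / fact k)"
  proof -
    define g where "g n j = \<beta> n / fact (Suc j) * (w ^ Suc (n + j) * D (Suc (n + j)) z)" for n j
    have "(\<Sum>n\<le>Suc M. \<beta> n * w ^ n * (\<Sum>j<Suc M - n. D (n + Suc j) z * w ^ Suc j / fact (Suc j)))
        = (\<Sum>n\<le>Suc M. \<Sum>j<Suc M - n. g n j)"
      unfolding sum_distrib_left g_def by (intro sum.cong refl) (simp add: power_add)
    also have "\<dots> = (\<Sum>n<Suc M. \<Sum>j<Suc M - n. g n j)"
      by (simp flip: lessThan_Suc_atMost)
    also have "\<dots> = (\<Sum>(n, j)\<in>(SIGMA n:{..<Suc M}. {..<Suc M - n}). g n j)"
      by (rule sum.Sigma) auto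
    also have "(SIGMA n:{..<Suc M}. {..<Suc M - n}) = {(n, j). n + j < Suc M}"
      by auto
    also have "(\<Sum>(n, j)\<in>\<dots>. g n j) = (\<Sum>k<Suc M. \<Sum>n\<le>k. g n (k - n))"
      by (rule sum.triangle_reindex)
    also have "\<dots> = (\<Sum>k<Suc M. w ^ Suc k * D (Suc k) z * of_real (a ^ k / fact k))"
    proof (intro sum.cong refl)
      fix k
      have "(\<Sum>n\<le>k. g n (k - n)) = (\<Sum>n\<le>k. w ^ Suc k * D (Suc k) z
              * of_real (bernoulli_poly n a / (fact n * fact (Suc (k - n)))))"
        by (intro sum.cong refl) (simp add: g_def \<beta>_def)
      also have "\<dots> = w ^ Suc k * D (Suc k) z * of_real (a ^ k / fact k)"
        by (simp only: sum_distrib_left[symmetric] of_real_sum[symmetric] bernoulli_poly_recurrence)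
      finally show "(\<Sum>n\<le>k. g n (k - n)) = w ^ Suc k * D (Suc k) z * of_real (a ^ k / fact k)" .
    qed
    also have "\<dots> = w * (\<Sum>k<Suc M. D (Suc k) z * (w * of_real a) ^ k / fact k)"
      unfolding sum_distrib_left by (intro sum.cong refl) (simp add: power_mult_distrib)
    finally show ?thesis .
  qed
  have "(\<Sum>n\<le>Suc M. \<beta> n * w ^ n * (D n (z + w) - D n z))
      = (\<Sum>n\<le>Suc M. \<beta> n * w ^ n * R n)
        + (\<Sum>n\<le>Suc M. \<beta> n * w ^ n * (\<Sum>j<Suc M - n. D (n + Suc j) z * w ^ Suc j / fact (Suc j)))"
    unfolding sum.distrib[symmetric] by (intro sum.cong refl) (simp add: R_def algebra_simps)
  then have "(\<Sum>n\<le>Suc M. \<beta> n * w ^ n * (D n (z + w) - D n z)) - w * D 1 (z + w * of_real a)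
      = (\<Sum>n\<le>Suc M. \<beta> n * w ^ n * R n) - w * R'"
    unfolding main R'_def by (simp add: algebra_simps)
  also have "norm \<dots> \<le> (\<Sum>n\<le>Suc M. norm (\<beta> n * w ^ n * R n)) + norm (w * R')"
    by (intro norm_triangle_le_diff add_mono norm_sum) auto
  also have "\<dots> \<le> (\<Sum>n\<le>Suc M. \<bar>bernoulli_poly n a / fact n\<bar> * (B * norm w ^ Suc (Suc M)))
                   + norm w * (B * (norm w * \<bar>a\<bar>) ^ Suc M)"
  proof (intro add_mono sum_mono)
    fix n assume "n \<in> {..Suc M}"
    then have n: "n \<le> Suc M" by simp
    have "norm (\<beta> n * w ^ n * R n) = \<bar>bernoulli_poly n a / fact n\<bar> * (norm w ^ n * norm (R n))"
      by (simp only: \<beta>_def norm_mult norm_power norm_of_real mult.assoc)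
    also have "\<dots> \<le> \<bar>bernoulli_poly n a / fact n\<bar> * (norm w ^ n * (B * norm w ^ Suc (Suc M - n)))"
      by (intro mult_left_mono R[OF n]) auto
    also have "norm w ^ n * (B * norm w ^ Suc (Suc M - n)) = B * norm w ^ (n + Suc (Suc M - n))"
      by (simp only: power_add mult_ac)
    also have "n + Suc (Suc M - n) = Suc (Suc M)"
      using n by simp
    finally show "norm (\<beta> n * w ^ n * R n) \<le> \<bar>bernoulli_poly n a / fact n\<bar> * (B * norm w ^ Suc (Suc M))" .
  qed (simp only: norm_mult mult_left_mono[OF R'] norm_ge_zero)
  also have "\<dots> = B * norm w ^ Suc (Suc M) * ((\<Sum>n\<le>Suc M. \<bar>bernoulli_poly n a / fact n\<bar>) + \<bar>a\<bar> ^ Suc M)"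
    by (simp add: sum_distrib_left sum_distrib_right power_mult_distrib algebra_simps)
  finally show ?thesis
    by (simp only: \<beta>_def)
qed

section \<open>The decaying kernel\<close>

text \<open>
  Times \<open>t\<close>, each term with positive index is at most the integral of the kernel over the preceding step of
  length \<open>t\<close>, and these integrals telescope. The factor \<open>t\<close> in front is what makes the bound
  uniform as \<open>t\<close> tends to \<open>0\<close>; it costs one power of \<open>w\<close> in the expansion.
\<close>

lemma powr_kernel_sum:
  fixes t \<epsilon> :: real
  assumes "0 < t" "0 < \<epsilon>"
  shows "summable (\<lambda>m. (1 + t * real m) powr (- 1 - \<epsilon>))"
    and "t * (\<Sum>m. (1 + t * real m) powr (- 1 - \<epsilon>)) \<le> t + 1 / \<epsilon>"
proof -
  have e: "- \<epsilon> - 1 = - 1 - \<epsilon>" by simp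
  define k where "k m = (1 + t * real m) powr (- 1 - \<epsilon>)" for m
  define g where "g m = (1 + t * real m) powr (- \<epsilon>) / \<epsilon>" for m
  have le: "t * k (Suc m) \<le> g m - g (Suc m)" for m
  proof -
    define x y where "x = t * real m" and "y = t * real (Suc m)"
    have xy: "0 \<le> x" "x < y" "y - x = t"
      using assms by (auto simp: x_def y_def algebra_simps)
    have der: "((\<lambda>x. (1 + x) powr (- \<epsilon>) / \<epsilon>) has_real_derivative - ((1 + u) powr (- 1 - \<epsilon>))) (at u)"
      if "x \<le> u" for u
      using that xy(1) assms by (auto intro!: derivative_eq_intros simp: e)
    obtain u where u: "x < u" "u < y"
      and eq: "(1 + y) powr (- \<epsilon>) / \<epsilon> - (1 + x) powr (- \<epsilon>) / \<epsilon> = (y - x) * - ((1 + u) powr (- 1 - \<epsilon>))"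
      using MVT2[OF xy(2) der] by blast
    have "(1 + y) powr (- 1 - \<epsilon>) \<le> (1 + u) powr (- 1 - \<epsilon>)"
      using u xy assms by (intro powr_mono2') auto
    then have "t * (1 + y) powr (- 1 - \<epsilon>) \<le> t * (1 + u) powr (- 1 - \<epsilon>)"
      using assms by (intro mult_left_mono) auto
    then have "t * (1 + y) powr (- 1 - \<epsilon>) \<le> (1 + x) powr (- \<epsilon>) / \<epsilon> - (1 + y) powr (- \<epsilon>) / \<epsilon>"
      using eq xy(3) by simp
    then show ?thesis
      by (simp add: k_def g_def x_def y_def)
  qed
  have "g \<longlonglongrightarrow> 0"
    unfolding g_def using assms by real_asymp
  then have g: "(\<lambda>m. g m - g (Suc m)) sums (g 0 - 0)"
    by (rule telescope_sums')
  have s: "summable (\<lambda>m. t * k (Suc m))"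
    by (rule summable_comparison_test'[OF sums_summable[OF g]])
       (use le assms in \<open>auto simp: k_def\<close>)
  then have sk: "summable k"
    using assms by (simp add: summable_cmult_iff summable_Suc_iff)
  then show "summable (\<lambda>m. (1 + t * real m) powr (- 1 - \<epsilon>))"
    by (simp add: k_def[abs_def])
  have "(\<Sum>m. t * k (Suc m)) \<le> (\<Sum>m. g m - g (Suc m))"
    using le s sums_summable[OF g] by (rule suminf_le)
  also have "\<dots> = 1 / \<epsilon>"
    using sums_unique[OF g] by (simp add: g_def)
  finally have "t * (\<Sum>m. k (Suc m)) \<le> 1 / \<epsilon>"
    using sk by (simp add: suminf_mult summable_Suc_iff)
  moreover have "(\<Sum>m. k m) = k 0 + (\<Sum>m. k (Suc m))"
    using suminf_split_head[OF sk] by simp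
  ultimately have "t * (\<Sum>m. k m) \<le> t + 1 / \<epsilon>"
    by (simp add: k_def algebra_simps)
  then show "t * (\<Sum>m. (1 + t * real m) powr (- 1 - \<epsilon>)) \<le> t + 1 / \<epsilon>"
    by (simp add: k_def)
qed

lemma powr_kernel_integrable:
  fixes \<epsilon> :: real
  assumes "0 < \<epsilon>"
  shows "(\<lambda>x. (1 + x) powr (- 1 - \<epsilon>)) integrable_on {0..}"
proof -
  have e: "- \<epsilon> - 1 = - 1 - \<epsilon>" by simp
  define G where "G x = - ((1 + x) powr (- \<epsilon>)) / \<epsilon>" for x
  have int: "((\<lambda>x. (1 + x) powr (- 1 - \<epsilon>)) has_integral G y - G 0) {0..y}" if "0 \<le> y" for y
    unfolding G_def using assms that
    by (intro fundamental_theorem_of_calculus)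
       (auto intro!: derivative_eq_intros simp: e
             simp flip: has_real_derivative_iff_has_vector_derivative)
  have "((\<lambda>x. (1 + x) powr (- 1 - \<epsilon>)) has_integral - G 0) {0..}"
  proof (rule has_integral_to_inf)
    show "(\<lambda>x. (1 + x) powr (- 1 - \<epsilon>)) integrable_on {0..y}" for y
      using int[of y] by (cases "0 \<le> y") (auto simp: integrable_on_def)
    have "\<forall>\<^sub>F y in at_top. integral {0..y} (\<lambda>x. (1 + x) powr (- 1 - \<epsilon>)) = G y - G 0"
      using int by (meson eventually_at_top_linorderI integral_unique)
    moreover have "((\<lambda>y. G y - G 0) \<longlongrightarrow> - G 0) at_top"
      using assms unfolding G_def by real_asymp
    ultimately show "((\<lambda>y. integral {0..y} (\<lambda>x. (1 + x) powr (- 1 - \<epsilon>))) \<longlongrightarrow> - G 0) at_top"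
      by (simp add: filterlim_cong)
  qed auto
  then show ?thesis
    by (auto simp: integrable_on_def)
qed

section \<open>Decaying functions and their primitives\<close>

text \<open>
  The decay hypothesis speaks only about large arguments. Continuity extends the estimate to the
  bounded part, with a kernel that has no singularity at \<open>0\<close>; the extra compact set \<open>C\<close> leaves room
  for arguments just outside the sector.
\<close>

lemma decay_bound:
  assumes \<theta>: "0 \<le> \<theta>" "\<theta> < pi / 2" and "compact C" and h: "continuous_on (sector \<theta> \<union> C) h"
    and decay: "sufficient_decay h (sector \<theta>)"
  obtains K \<epsilon> where "0 < \<epsilon>" "0 \<le> K"
    "\<And>z. z \<in> sector \<theta> \<union> C \<Longrightarrow> norm (h z) \<le> K * (1 + norm z) powr (- 1 - \<epsilon>)"
proof -
  obtain \<epsilon> where \<epsilon>: "0 < \<epsilon>"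
    and O: "(\<lambda>w. norm (h w)) \<in> O[inf at_infinity (principal (sector \<theta>))](\<lambda>w. norm w powr (- 1 - \<epsilon>))"
    using decay unfolding sufficient_decay_def by blast
  obtain c where c: "0 < c" and
    ev: "\<forall>\<^sub>F w in inf at_infinity (principal (sector \<theta>)). norm (norm (h w)) \<le> c * norm (norm w powr (- 1 - \<epsilon>))"
    using landau_o.bigE[OF O] by blast
  obtain R where R: "0 < R" and
    far: "\<And>z. z \<in> sector \<theta> \<Longrightarrow> R \<le> norm z \<Longrightarrow> norm (h z) \<le> c * norm z powr (- 1 - \<epsilon>)"
    using ev unfolding eventually_inf_principal eventually_at_infinity_pos by auto
  define R' where "R' = max 1 R"
  \<comment> \<open>On this compact part continuity gives the bound, on the rest of the sector the decay does.\<close>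
  define A where "A = (sector \<theta> \<inter> cball 0 R') \<union> C"
  have "compact A"
    unfolding A_def using \<open>compact C\<close> closed_sector[OF \<theta>] by (intro compact_Un closed_Int_compact) auto
  moreover have "continuous_on A h"
    by (rule continuous_on_subset[OF h]) (auto simp: A_def)
  ultimately have "bounded (h ` A)" "bounded A"
    by (auto intro: compact_imp_bounded compact_continuous_image)
  then obtain B Q where B: "\<And>z. z \<in> A \<Longrightarrow> norm (h z) \<le> B" and Q: "\<And>z. z \<in> A \<Longrightarrow> norm z \<le> Q"
    unfolding bounded_iff by blast
  \<comment> \<open>\<open>K1\<close> divides by the least value of the kernel for \<open>norm z \<le> Q\<close>; \<open>K2\<close> uses
      \<open>norm z \<ge> (1 + norm z) / 2\<close> for \<open>norm z \<ge> 1\<close>.\<close>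
  define K1 where "K1 = max 0 B / (1 + max 0 Q) powr (- 1 - \<epsilon>)"
  define K2 where "K2 = c * (1 / 2) powr (- 1 - \<epsilon>)"
  show thesis
  proof
    show "0 \<le> max K1 K2"
      unfolding K1_def by (simp add: le_max_iff_disj)
    fix z assume z: "z \<in> sector \<theta> \<union> C"
    have "norm (h z) \<le> K1 * (1 + norm z) powr (- 1 - \<epsilon>) \<or> norm (h z) \<le> K2 * (1 + norm z) powr (- 1 - \<epsilon>)"
    proof (cases "z \<in> A")
      case True
      have "max 0 B = K1 * (1 + max 0 Q) powr (- 1 - \<epsilon>)"
        by (simp add: K1_def)
      also have "\<dots> \<le> K1 * (1 + norm z) powr (- 1 - \<epsilon>)"
        using Q[OF True] \<epsilon> by (intro mult_left_mono powr_mono2') (auto simp: K1_def intro: add_pos_nonneg)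
      finally show ?thesis
        using B[OF True] by auto
    next
      case False
      then have zs: "z \<in> sector \<theta>" "R' < norm z"
        using z by (auto simp: A_def)
      then have "norm (h z) \<le> c * norm z powr (- 1 - \<epsilon>)"
        by (intro far) (auto simp: R'_def)
      also have "\<dots> \<le> c * (1 / 2 * (1 + norm z)) powr (- 1 - \<epsilon>)"
        using zs c \<epsilon> by (intro mult_left_mono powr_mono2') (auto simp: R'_def)
      also have "\<dots> = K2 * (1 + norm z) powr (- 1 - \<epsilon>)"
        unfolding K2_def by (subst powr_mult) auto
      finally show ?thesis ..
    qed
    then show "norm (h z) \<le> max K1 K2 * (1 + norm z) powr (- 1 - \<epsilon>)"
      by (smt (verit) mult_right_mono powr_ge_zero)
  qed (rule \<epsilon>)
qed

text \<open>
  If \<open>a\<close> is negative, the first samples may lie outside the sector, where nothing is known about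
  \<open>f\<close>; there are finitely many of them.
\<close>

lemma summable_decaying_samples:
  fixes f :: "complex \<Rightarrow> complex" and a :: real
  assumes \<theta>: "0 \<le> \<theta>" "\<theta> < pi / 2" and w: "w \<in> sector \<theta>" "w \<noteq> 0" and \<epsilon>: "0 < \<epsilon>"
    and f: "\<And>z. z \<in> sector \<theta> \<Longrightarrow> norm (f z) \<le> K * (1 + norm z) powr (- 1 - \<epsilon>)" and K: "0 \<le> K"
  shows "summable (\<lambda>m. f (w * of_real (real m + a)))"
proof -
  obtain k :: nat where k: "- a \<le> real k"
    using real_arch_simple by blast
  have "summable (\<lambda>m. f (w * of_real (real (m + k) + a)))"
  proof (rule summable_comparison_test')
    show "summable (\<lambda>m. K * (1 + norm w * real m) powr (- 1 - \<epsilon>))"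
      using powr_kernel_sum(1)[of "norm w" \<epsilon>] w \<epsilon> by (intro summable_mult) auto
    fix m :: nat
    have "norm (f (w * of_real (real (m + k) + a))) \<le> K * (1 + norm (w * of_real (real (m + k) + a))) powr (- 1 - \<epsilon>)"
      using k by (intro f sector_scale \<theta> w) auto
    also have "\<dots> \<le> K * (1 + norm w * real m) powr (- 1 - \<epsilon>)"
    proof (intro mult_left_mono powr_mono2' K add_left_mono)
      have "norm w * real m \<le> norm w * (real (m + k) + a)"
        using k by (intro mult_left_mono) auto
      moreover have "real (m + k) + a = \<bar>real (m + k) + a\<bar>"
        using k by simp
      ultimately show "norm w * real m \<le> norm (w * of_real (real (m + k) + a))"
        by (simp only: norm_mult norm_of_real)
    qed (use \<epsilon> in \<open>auto intro: add_pos_nonneg\<close>)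
    finally show "norm (f (w * of_real (real (m + k) + a))) \<le> K * (1 + norm w * real m) powr (- 1 - \<epsilon>)" .
  qed
  then show ?thesis
    by (subst (asm) summable_iff_shift)
qed

lemma decay_tendsto_0:
  fixes f :: "complex \<Rightarrow> complex"
  assumes \<theta>: "0 \<le> \<theta>" "\<theta> < pi / 2" and w: "w \<in> sector \<theta>" "w \<noteq> 0" and \<epsilon>: "0 < \<epsilon>"
    and f: "\<And>z. z \<in> sector \<theta> \<Longrightarrow> norm (f z) \<le> K * (1 + norm z) powr (- 1 - \<epsilon>)" and K: "0 \<le> K"
  shows "(\<lambda>m. f (w * of_real (real m))) \<longlonglongrightarrow> 0"
  using summable_LIMSEQ_zero[OF summable_decaying_samples[OF assms, where a = 0]] by simp

text \<open>
  A neighbourhood of the compact segment to \<open>z\<close> lies in \<open>S\<close>, and it contains the segments to all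
  points near \<open>z\<close>.
\<close>

lemma open_star_part:
  fixes S :: "'a::euclidean_space set"
  assumes "open S"
  shows "open {z. closed_segment 0 z \<subseteq> S}"
  unfolding open_contains_ball
proof
  fix z assume "z \<in> {z. closed_segment 0 z \<subseteq> S}"
  then have z: "closed_segment 0 z \<subseteq> S" by simp
  obtain e where e: "0 < e" "(\<Union>x\<in>closed_segment 0 z. ball x e) \<subseteq> S"
    using compact_subset_open_imp_ball_epsilon_subset[OF compact_segment assms z] by blast
  have "closed_segment 0 y \<subseteq> S" if y: "y \<in> ball z e" for y
  proof
    fix p assume "p \<in> closed_segment 0 y"
    then obtain u where u: "0 \<le> u" "u \<le> 1" "p = u *\<^sub>R y"
      by (auto simp: in_segment)
    have "dist (u *\<^sub>R z) p = u * dist z y"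
      using u by (simp add: dist_norm flip: scaleR_right_diff_distrib)
    also have "\<dots> \<le> 1 * dist z y"
      using u by (intro mult_right_mono) auto
    also have "\<dots> < e"
      using y by simp
    finally have "p \<in> ball (u *\<^sub>R z) e" by simp
    moreover have "u *\<^sub>R z \<in> closed_segment 0 z"
      using u by (auto simp: in_segment)
    ultimately show "p \<in> S"
      using e by blast
  qed
  then have "ball z e \<subseteq> {z. closed_segment 0 z \<subseteq> S}" by blast
  then show "\<exists>e>0. ball z e \<subseteq> {z. closed_segment 0 z \<subseteq> S}"
    using e(1) by blast
qed

text \<open>
  The domain of holomorphy need not be simply connected, so a primitive may fail to exist on all of
  it. The points that \<open>S\<close> lets one see from the origin form a star-shaped open set, on which it does.
\<close>

lemma primitive_on_star_part:
  assumes "open S" "f holomorphic_on S" "0 \<in> S"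
  obtains F where "\<And>z. closed_segment 0 z \<subseteq> S \<Longrightarrow> (F has_field_derivative f z) (at z)"
proof -
  define T where "T = {z. closed_segment 0 z \<subseteq> S}"
  have T: "open T" "T \<subseteq> S" "0 \<in> T"
    using open_star_part[OF assms(1)] assms(3) by (auto simp: T_def)
  have "starlike T"
    unfolding starlike_def
  proof (intro bexI[of _ 0] ballI)
    fix x assume "x \<in> T"
    then show "closed_segment 0 x \<subseteq> T"
      unfolding T_def using subset_closed_segment[of 0 _ 0 x] by auto
  qed (rule T(3))
  have "f holomorphic_on T"
    using assms(2) T(2) by (rule holomorphic_on_subset)
  then have "\<exists>F. \<forall>z\<in>T. (F has_field_derivative f z) (at z)"
    using T(1)
    by (intro holomorphic_starlike_primitive[OF _ \<open>starlike T\<close> _ finite.emptyI] holomorphic_on_imp_continuous_on)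
       (auto simp: holomorphic_on_open field_differentiable_def)
  then show thesis
    using that unfolding T_def by blast
qed

text \<open>
  The fundamental theorem of calculus on \<open>[0, X k]\<close> and dominated convergence. The limit is stated
  along an arbitrary sequence since it is needed at the points \<open>norm w * k\<close>.
\<close>

lemma primitive_tendsto_improper_integral:
  fixes F f :: "complex \<Rightarrow> complex" and X :: "nat \<Rightarrow> real"
  assumes F: "\<And>x::real. 0 \<le> x \<Longrightarrow> (F has_field_derivative f (of_real x)) (at (of_real x))"
    and f: "\<And>x::real. 0 \<le> x \<Longrightarrow> norm (f (of_real x)) \<le> C * (1 + x) powr (- 1 - \<epsilon>)" and "0 < \<epsilon>"
    and X: "\<And>k. 0 \<le> X k" "filterlim X at_top sequentially"
  shows "(\<lambda>x::real. f (of_real x)) integrable_on {0..}"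
    and "(\<lambda>k. F (of_real (X k))) \<longlonglongrightarrow> F 0 + integral {0..} (\<lambda>x::real. f (of_real x))"
proof -
  define g where "g k x = (if x \<in> {0..X k} then f (of_real x) else 0)" for k and x :: real
  have int: "(g k has_integral F (of_real (X k)) - F 0) {0..}" for k
  proof -
    have "((\<lambda>x. f (of_real x)) has_integral F (of_real (X k)) - F (of_real 0)) {0..X k}"
    proof (rule fundamental_theorem_of_calculus[OF X(1)])
      fix x :: real assume "x \<in> {0..X k}"
      then have "(F has_field_derivative f (of_real x)) (at (of_real x))"
        by (intro F) auto
      then show "((\<lambda>x. F (of_real x)) has_vector_derivative f (of_real x)) (at x within {0..X k})"
        by (rule has_vector_derivative_at_within[OF has_vector_derivative_real_field])
    qed
    then show ?thesis
      unfolding g_def by (subst has_integral_restrict) auto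
  qed
  have dom: "(\<lambda>x. C * (1 + x) powr (- 1 - \<epsilon>)) integrable_on {0..}"
    using powr_kernel_integrable[OF \<open>0 < \<epsilon>\<close>] by (rule integrable_on_mult_right)
  have bd: "norm (g k x) \<le> C * (1 + x) powr (- 1 - \<epsilon>)" if "x \<in> {0..}" for k x
    using f[of x] order_trans[OF norm_ge_zero f[of x]] that unfolding g_def by auto
  have conv: "(\<lambda>k. g k x) \<longlonglongrightarrow> f (of_real x)" if "x \<in> {0..}" for x
  proof (rule tendsto_eventually)
    have "\<forall>\<^sub>F k in sequentially. x \<le> X k"
      using X(2) by (auto simp: filterlim_at_top)
    then show "\<forall>\<^sub>F k in sequentially. g k x = f (of_real x)"
      by eventually_elim (use that in \<open>auto simp: g_def\<close>)
  qed
  note dc = dominated_convergence[OF has_integral_integrable[OF int] dom bd conv]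
  show "(\<lambda>x::real. f (of_real x)) integrable_on {0..}"
    by (rule dc(1)) auto
  have "(\<lambda>k. integral {0..} (g k)) \<longlonglongrightarrow> integral {0..} (\<lambda>x::real. f (of_real x))"
    by (rule dc(2)) auto
  then have "(\<lambda>k. F (of_real (X k)) - F 0) \<longlonglongrightarrow> integral {0..} (\<lambda>x::real. f (of_real x))"
    by (simp only: integral_unique[OF int])
  then have "(\<lambda>k. F 0 + (F (of_real (X k)) - F 0)) \<longlonglongrightarrow> F 0 + integral {0..} (\<lambda>x::real. f (of_real x))"
    by (intro tendsto_add tendsto_const)
  then show "(\<lambda>k. F (of_real (X k))) \<longlonglongrightarrow> F 0 + integral {0..} (\<lambda>x::real. f (of_real x))"
    by simp
qed

text \<open>
  This replaces the rotation of the integration path from the ray through \<open>w\<close> to the real axis. The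
  points \<open>z = w m\<close> and \<open>norm z\<close> are joined by a segment of length at most \<open>2 * norm z\<close> which stays at a
  distance at least \<open>cos \<theta> * norm z\<close> from the origin, so the decay of \<open>f\<close> makes the primitive take
  asymptotically equal values at its ends; note that \<open>cos \<theta>\<close> is positive.
\<close>

lemma decaying_primitive_ray_limit:
  assumes \<theta>: "0 \<le> \<theta>" "\<theta> < pi / 2" and w: "w \<in> sector \<theta>" "w \<noteq> 0" and \<epsilon>: "0 < \<epsilon>"
    and F: "\<And>z. z \<in> sector \<theta> \<Longrightarrow> (F has_field_derivative f z) (at z)"
    and f: "\<And>z. z \<in> sector \<theta> \<Longrightarrow> norm (f z) \<le> K * (1 + norm z) powr (- 1 - \<epsilon>)"
  shows "(\<lambda>m. F (w * of_real (real m))) \<longlonglongrightarrow> F 0 + integral {0..} (\<lambda>x::real. f (of_real x))"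
proof -
  define c where "c = cos \<theta>"
  have c: "0 < c" "c \<le> 1"
    using \<theta> by (auto simp: c_def intro!: cos_gt_zero_pi)
  define r where "r = norm w"
  have r: "0 < r" using w by (simp add: r_def)
  have K: "0 \<le> K"
    using order_trans[OF norm_ge_zero f[OF of_real_in_sector[OF \<theta> order_refl]]] by simp
  have real: "(\<lambda>m. F (of_real (r * real m))) \<longlonglongrightarrow> F 0 + integral {0..} (\<lambda>x::real. f (of_real x))"
  proof (rule primitive_tendsto_improper_integral(2))
    fix x :: real assume x: "0 \<le> x"
    show "(F has_field_derivative f (of_real x)) (at (of_real x))"
      by (intro F of_real_in_sector \<theta> x)
    show "norm (f (of_real x)) \<le> K * (1 + x) powr (- 1 - \<epsilon>)"
      using f[OF of_real_in_sector[OF \<theta> x]] x by simp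
  next
    show "filterlim (\<lambda>m. r * real m) at_top sequentially"
      using r by real_asymp
  qed (use r \<epsilon> in auto)
  have diff: "norm (F (w * of_real (real m)) - F (of_real (r * real m)))
      \<le> K * ((1 + c * (r * real m)) powr (- 1 - \<epsilon>) * (2 * (r * real m)))" for m
  proof -
    define z where "z = w * of_real (real m)"
    have nz: "norm z = r * real m"
      by (simp add: z_def r_def norm_mult)
    have z: "z \<in> sector \<theta>"
      unfolding z_def by (intro sector_scale \<theta> w) auto
    have z': "of_real (norm z) \<in> sector \<theta>"
      by (intro of_real_in_sector \<theta>) auto
    define J where "J = closed_segment z (of_real (norm z))"
    have J: "J \<subseteq> sector \<theta>"
      unfolding J_def using z z' convex_sector[OF \<theta>] by (simp add: closed_segment_subset)
    \<comment> \<open>The real part is at least \<open>c * norm z\<close> at both ends of the segment, hence all along it.\<close>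
    have low: "c * norm z \<le> norm p" if "p \<in> J" for p
    proof -
      have "J \<subseteq> {p. c * norm z \<le> Re p}"
        unfolding J_def
      proof (rule closed_segment_subset)
        show "z \<in> {p. c * norm z \<le> Re p}"
          using z by (simp add: sector_eq[OF \<theta>] c_def mult.commute)
        show "of_real (norm z) \<in> {p. c * norm z \<le> Re p}"
          using c by (simp add: mult_left_le_one_le)
        show "convex {p. c * norm z \<le> Re p}"
          using convex_halfspace_ge[of "c * norm z" "1 :: complex"] by (simp add: inner_complex_def)
      qed
      then show ?thesis
        using that complex_Re_le_cmod[of p] by force
    qed
    have "norm (F z - F (of_real (norm z))) \<le> K * (1 + c * norm z) powr (- 1 - \<epsilon>) * norm (z - of_real (norm z))"
    proof (rule field_differentiable_bound[of J F f])
      show "convex J" "z \<in> J" "of_real (norm z) \<in> J"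
        by (auto simp: J_def)
      fix p assume p: "p \<in> J"
      then show "(F has_field_derivative f p) (at p within J)"
        using J by (intro has_field_derivative_at_within[OF F]) auto
      have "norm (f p) \<le> K * (1 + norm p) powr (- 1 - \<epsilon>)"
        using p J by (intro f) auto
      also have "\<dots> \<le> K * (1 + c * norm z) powr (- 1 - \<epsilon>)"
        using low[OF p] c K \<epsilon> by (intro mult_left_mono powr_mono2') (auto intro: add_pos_nonneg)
      finally show "norm (f p) \<le> K * (1 + c * norm z) powr (- 1 - \<epsilon>)" .
    qed
    also have "\<dots> \<le> K * (1 + c * norm z) powr (- 1 - \<epsilon>) * (2 * norm z)"
      using K norm_triangle_ineq4[of z "of_real (norm z)"] by (intro mult_left_mono) auto
    finally show ?thesis
      unfolding nz by (simp add: z_def mult.assoc)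
  qed
  have "(\<lambda>m. (1 + c * (r * real m)) powr (- 1 - \<epsilon>) * (2 * (r * real m))) \<longlonglongrightarrow> 0"
    using c(1) r \<epsilon> by real_asymp
  then have "(\<lambda>m. K * ((1 + c * (r * real m)) powr (- 1 - \<epsilon>) * (2 * (r * real m)))) \<longlonglongrightarrow> 0"
    by (rule tendsto_mult_right_zero)
  then have "(\<lambda>m. F (w * of_real (real m)) - F (of_real (r * real m))) \<longlonglongrightarrow> 0"
    by (rule Lim_null_comparison[rotated]) (use diff in auto)
  from tendsto_add[OF this real] show ?thesis
    by simp
qed

section \<open>The asymptotic expansion\<close>

text \<open>
  Summing the local formula over the points \<open>z = w m\<close>, the differences telescope: the upper end
  contributes only the limit \<open>L\<close> of \<open>D 0\<close>, the lower end the terms of the expansion. The local errors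
  are sampled values of a decaying function, hence summable, with a total that exceeds a single one
  by a factor of order \<open>1 / norm w\<close>. The assumptions range over \<open>s \<ge> - b\<close> because the samples
  \<open>w (m + a)\<close> start at \<open>w a\<close>, which for negative \<open>a\<close> lies behind the origin.
\<close>

lemma Euler_Maclaurin_ray:
  fixes D :: "nat \<Rightarrow> complex \<Rightarrow> complex" and a \<epsilon> C :: real and w L :: complex and M :: nat
  defines "b \<equiv> max 1 \<bar>a\<bar>"
  defines "A \<equiv> (\<Sum>n\<le>Suc M. \<bar>bernoulli_poly n a / fact n\<bar>) + \<bar>a\<bar> ^ Suc M"
  assumes "w \<noteq> 0" and wb: "norm w * b \<le> 1" and \<epsilon>: "0 < \<epsilon>" and C: "0 \<le> C"
    and D: "\<And>i s. - b \<le> s \<Longrightarrow> i \<le> Suc M \<Longrightarrow>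
              (D i has_field_derivative D (Suc i) (w * of_real s)) (at (w * of_real s))"
    and bound: "\<And>s. - b \<le> s \<Longrightarrow>
              norm (D (Suc (Suc M)) (w * of_real s)) \<le> C * (1 + norm w * \<bar>s\<bar>) powr (- 1 - \<epsilon>)"
    and lim0: "(\<lambda>m. D 0 (w * of_real (real m))) \<longlonglongrightarrow> L"
    and lim: "\<And>n. n \<le> M \<Longrightarrow> (\<lambda>m. D (Suc n) (w * of_real (real m))) \<longlonglongrightarrow> 0"
    and summable: "summable (\<lambda>m. D 1 (w * of_real (real m + a)))"
  shows "norm (L - (\<Sum>n\<le>Suc M. of_real (bernoulli_poly n a / fact n) * w ^ n * D n 0)
                 - w * (\<Sum>m. D 1 (w * of_real (real m + a))))
         \<le> C * (1 / 2) powr (- 1 - \<epsilon>) * A * (1 + 1 / \<epsilon>) * norm w ^ Suc M"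
proof -
  define e where "e m = (\<Sum>n\<le>Suc M. of_real (bernoulli_poly n a / fact n) * w ^ n * D n (w * of_real (real m)))" for m
  define k where "k m = (1 + norm w * real m) powr (- 1 - \<epsilon>)" for m
  define C' where "C' = C * (1 / 2) powr (- 1 - \<epsilon>)"
  define err where "err m = e (Suc m) - e m - w * D 1 (w * of_real (real m + a))" for m
  have b: "1 \<le> b" "\<bar>a\<bar> \<le> b" by (auto simp: b_def)
  have A: "0 \<le> A" unfolding A_def by (intro add_nonneg_nonneg sum_nonneg) auto
  have w: "0 < norm w" "norm w \<le> 1"
    using \<open>w \<noteq> 0\<close> order_trans[OF mult_left_mono[OF b(1), of "norm w"] wb] by auto
  have err: "norm (err m) \<le> C' * k m * norm w ^ Suc (Suc M) * A" for m
  proof -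
    define K where "K = (\<lambda>s. w * of_real s) ` {real m - b..real m + b}"
    have "convex K"
      unfolding K_def
      by (intro convex_linear_image convex_real_interval)
         (simp add: linear_iff algebra_simps scaleR_conv_of_real)
    have "norm ((\<Sum>n\<le>Suc M. of_real (bernoulli_poly n a / fact n) * w ^ n
                     * (D n (w * of_real (real m) + w) - D n (w * of_real (real m))))
                   - w * D 1 (w * of_real (real m) + w * of_real a))
          \<le> C' * k m * norm w ^ Suc (Suc M) * A"
      unfolding A_def
    proof (rule Euler_Maclaurin_step[OF \<open>convex K\<close>])
      have in_K: "w * of_real s \<in> K" if "real m - b \<le> s" "s \<le> real m + b" for s
        unfolding K_def using that by auto
      show "w * of_real (real m) \<in> K"
        using b by (intro in_K) auto
      show "w * of_real (real m) + w \<in> K"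
        using in_K[of "real m + 1"] b by (simp add: distrib_left)
      show "w * of_real (real m) + w * of_real a \<in> K"
        using in_K[of "real m + a"] b by (auto simp: distrib_left)
    next
      fix i x assume "x \<in> K" "i \<le> Suc M"
      then obtain s where "x = w * of_real s" "s \<in> {real m - b..real m + b}"
        unfolding K_def by blast
      moreover from this have "- b \<le> s" by simp
      ultimately show "(D i has_field_derivative D (Suc i) x) (at x within K)"
        using has_field_derivative_at_within[OF D[OF _ \<open>i \<le> Suc M\<close>]] by simp
    next
      fix x assume "x \<in> K"
      then obtain s where x: "x = w * of_real s" and "s \<in> {real m - b..real m + b}"
        unfolding K_def by blast
      then have s: "real m - b \<le> s" "s \<le> real m + b"
        by auto
      \<comment> \<open>The point \<open>s\<close> is within \<open>b\<close> of \<open>m\<close> and \<open>norm w * b \<le> 1\<close>, so replacing \<open>s\<close> by \<open>m\<close> in the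
          kernel costs only a constant factor.\<close>
      have "norm w * real m \<le> norm w * (\<bar>s\<bar> + b)"
        using s by (intro mult_left_mono) auto
      also have "\<dots> \<le> norm w * \<bar>s\<bar> + 1"
        using wb by (simp add: distrib_left)
      also have "\<dots> \<le> 1 + 2 * (norm w * \<bar>s\<bar>)"
        by simp
      finally have le: "1 / 2 * (1 + norm w * real m) \<le> 1 + norm w * \<bar>s\<bar>"
        by simp
      have "norm (D (Suc (Suc M)) x) \<le> C * (1 + norm w * \<bar>s\<bar>) powr (- 1 - \<epsilon>)"
        unfolding x using s(1) by (intro bound) auto
      also have "\<dots> \<le> C * (1 / 2 * (1 + norm w * real m)) powr (- 1 - \<epsilon>)"
        using le \<epsilon> C by (intro mult_left_mono powr_mono2') (auto intro: add_pos_nonneg)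
      also have "\<dots> = C' * k m"
        unfolding C'_def k_def by (subst powr_mult) auto
      finally show "norm (D (Suc (Suc M)) x) \<le> C' * k m" .
    qed
    moreover have "err m = (\<Sum>n\<le>Suc M. of_real (bernoulli_poly n a / fact n) * w ^ n
                     * (D n (w * of_real (real m) + w) - D n (w * of_real (real m))))
                   - w * D 1 (w * of_real (real m) + w * of_real a)"
      unfolding err_def e_def sum_subtractf[symmetric] right_diff_distrib
      by (simp add: algebra_simps)
    ultimately show ?thesis by simp
  qed
  have "e \<longlonglongrightarrow> (\<Sum>n\<le>Suc M. of_real (bernoulli_poly n a / fact n) * w ^ n * (if n = 0 then L else 0))"
    unfolding e_def
  proof (intro tendsto_sum tendsto_mult tendsto_const)
    fix n assume "n \<in> {..Suc M}"
    then show "(\<lambda>m. D n (w * of_real (real m))) \<longlonglongrightarrow> (if n = 0 then L else 0)"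
      using lim0 lim by (cases n) auto
  qed
  also have "(\<Sum>n\<le>Suc M. of_real (bernoulli_poly n a / fact n) * w ^ n * (if n = 0 then L else 0)) = L"
    by (subst sum.remove[of _ 0]) auto
  finally have "(\<lambda>m. e (Suc m) - e m) sums (L - e 0)"
    by (rule telescope_sums)
  then have "err sums (L - e 0 - w * (\<Sum>m. D 1 (w * of_real (real m + a))))"
    unfolding err_def by (rule sums_diff[OF _ sums_mult[OF summable_sums[OF summable]]])
  then have "norm (L - e 0 - w * (\<Sum>m. D 1 (w * of_real (real m + a)))) = norm (suminf err)"
    by (simp add: sums_iff)
  also have "\<dots> \<le> (\<Sum>m. C' * k m * norm w ^ Suc (Suc M) * A)"
    using powr_kernel_sum(1)[OF w(1) \<epsilon>] err
    by (intro norm_suminf_le summable_mult2 summable_mult) (auto simp: k_def)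
  also have "\<dots> = C' * A * norm w ^ Suc M * (norm w * suminf k)"
    using powr_kernel_sum(1)[OF w(1) \<epsilon>]
    by (simp add: suminf_mult suminf_mult2[symmetric] k_def[abs_def] summable_mult mult_ac)
  also have "\<dots> \<le> C' * A * norm w ^ Suc M * (1 + 1 / \<epsilon>)"
    using powr_kernel_sum(2)[OF w(1) \<epsilon>] w(2) A C
    by (intro mult_left_mono) (auto simp: k_def[abs_def] C'_def)
  finally show ?thesis
    by (simp add: C'_def e_def mult_ac)
qed

theorem theorem1p2:
  fixes f :: "complex \<Rightarrow> complex" and S :: "complex set" and \<theta> a :: real and N :: nat
  assumes "0 \<le> \<theta>" and "\<theta> < pi / 2"
    and "open S" and "connected S" and "sector \<theta> \<subseteq> S"
    and "f holomorphic_on S"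
    and "\<forall>n. sufficient_decay ((deriv ^^ n) f) (sector \<theta>)"
  shows "(\<lambda>x::real. f (of_real x)) integrable_on {0..} \<and>
         (\<forall>w \<in> sector \<theta> - {0}. summable (\<lambda>m::nat. f (w * of_real (real m + a)))) \<and>
         (\<lambda>w. (\<Sum>m::nat. f (w * of_real (real m + a)))
            - (1 / w * integral {0..} (\<lambda>x::real. f (of_real x))
               - (\<Sum>n<N. of_real (bernoulli_poly (n + 1) a) * (deriv ^^ n) f 0 / fact (n + 1) * w ^ n)))
         \<in> O[at 0 within sector \<theta>](\<lambda>w. w ^ N)"
proof -
  note \<theta> = assms(1,2)
  define I where "I = integral {0..} (\<lambda>x::real. f (of_real x))"
  define T where "T = {z. closed_segment 0 z \<subseteq> S}"
  have "0 \<in> sector \<theta>"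
    using of_real_in_sector[OF \<theta>, of 0] by simp
  then have sector_T: "sector \<theta> \<subseteq> T"
    unfolding T_def using convex_sector[OF \<theta>] assms(5) closed_segment_subset by blast
  have T: "open T" "T \<subseteq> S"
    unfolding T_def by (auto intro: open_star_part assms(3))
  have "0 \<in> T" "0 \<in> S"
    using sector_T T(2) \<open>0 \<in> sector \<theta>\<close> by auto
  have hol: "f holomorphic_on T"
    using assms(6) T(2) by (rule holomorphic_on_subset)
  obtain F where F: "\<And>z. closed_segment 0 z \<subseteq> S \<Longrightarrow> (F has_field_derivative f z) (at z)"
    by (rule primitive_on_star_part[OF assms(3,6) \<open>0 \<in> S\<close>]) (rule that, blast)
  \<comment> \<open>The primitive plays the role of the derivative of order \<open>-1\<close>, so the indices are shifted by
      one; the normalisation \<open>D 0 0 = 0\<close> removes the singular term \<open>F 0 / w\<close> of the expansion.\<close>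
  define D where "D n = (case n of 0 \<Rightarrow> \<lambda>z. F z - F 0 | Suc k \<Rightarrow> (deriv ^^ k) f)" for n
  have D_simps: "D 0 = (\<lambda>z. F z - F 0)" "\<And>k. D (Suc k) = (deriv ^^ k) f"
    by (simp_all add: D_def)
  have D: "(D i has_field_derivative D (Suc i) z) (at z)" if "z \<in> T" for i z
  proof (cases i)
    case 0
    then show ?thesis
      using F[of z] that by (auto simp: D_simps T_def intro!: derivative_eq_intros)
  next
    case (Suc k)
    then show ?thesis
      using has_field_derivative_higher_deriv[OF hol T(1) that, of k] by (simp add: D_simps)
  qed
  \<comment> \<open>If \<open>a\<close> is negative, some sample points leave the sector; for small \<open>w\<close> they stay in this disc.\<close>
  obtain \<delta> where \<delta>: "0 < \<delta>" "cball 0 \<delta> \<subseteq> T"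
    using T(1) \<open>0 \<in> T\<close> open_contains_cball by blast
  have decay: "\<exists>K \<epsilon>. 0 < \<epsilon> \<and> 0 \<le> K \<and>
      (\<forall>z \<in> sector \<theta> \<union> cball 0 \<delta>. norm (D (Suc n) z) \<le> K * (1 + norm z) powr (- 1 - \<epsilon>))" for n
  proof -
    have "continuous_on (sector \<theta> \<union> cball 0 \<delta>) (D (Suc n))"
      using sector_T \<delta>(2) by (intro continuous_at_imp_continuous_on ballI DERIV_isCont[OF D]) blast
    moreover have "sufficient_decay (D (Suc n)) (sector \<theta>)"
      using assms(7) by (simp add: D_simps)
    ultimately show ?thesis
      by (metis decay_bound[OF \<theta> compact_cball])
  qed
  obtain K \<epsilon> where \<epsilon>: "0 < \<epsilon>" and K: "0 \<le> K"
    and f: "\<And>z. z \<in> sector \<theta> \<Longrightarrow> norm (f z) \<le> K * (1 + norm z) powr (- 1 - \<epsilon>)"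
    using decay[of 0] by (auto simp: D_simps)
  have F_sector: "(F has_field_derivative f z) (at z)" if "z \<in> sector \<theta>" for z
    using F[of z] that sector_T by (auto simp: T_def)
  have integrable: "(\<lambda>x::real. f (of_real x)) integrable_on {0..}"
  proof (rule primitive_tendsto_improper_integral(1)[where F = F and X = real and \<epsilon> = \<epsilon> and C = K])
    fix x :: real assume x: "0 \<le> x"
    show "(F has_field_derivative f (of_real x)) (at (of_real x))"
      by (intro F_sector of_real_in_sector \<theta> x)
    show "norm (f (of_real x)) \<le> K * (1 + x) powr (- 1 - \<epsilon>)"
      using f[OF of_real_in_sector[OF \<theta> x]] x by simp
  qed (auto simp: \<epsilon> filterlim_real_sequentially)
  have summable: "summable (\<lambda>m. f (w * of_real (real m + a)))" if "w \<in> sector \<theta>" "w \<noteq> 0" for w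
    by (rule summable_decaying_samples[OF \<theta> that \<epsilon> f K])
  obtain C \<eta> where \<eta>: "0 < \<eta>" and C: "0 \<le> C"
    and bound: "\<And>z. z \<in> sector \<theta> \<union> cball 0 \<delta> \<Longrightarrow> norm (D (Suc (Suc N)) z) \<le> C * (1 + norm z) powr (- 1 - \<eta>)"
    using decay by blast
  define b where "b = max 1 \<bar>a\<bar>"
  define A where "A = (\<Sum>n\<le>Suc N. \<bar>bernoulli_poly n a / fact n\<bar>) + \<bar>a\<bar> ^ Suc N"
  define C' where "C' = C * (1 / 2) powr (- 1 - \<eta>) * A * (1 + 1 / \<eta>)"
  define c where "c n = of_real (bernoulli_poly (n + 1) a) * (deriv ^^ n) f 0 / fact (n + 1)" for n
  have b: "1 \<le> b" by (simp add: b_def)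
  have estimate: "norm ((\<Sum>m. f (w * of_real (real m + a))) - (1 / w * I - (\<Sum>n<N. c n * w ^ n)))
                  \<le> (C' + norm (c N)) * norm (w ^ N)"
    if w: "w \<in> sector \<theta>" "w \<noteq> 0" and small: "norm w * b \<le> min 1 \<delta>" for w
  proof -
    have mem: "w * of_real s \<in> sector \<theta> \<union> cball 0 \<delta>" if "- b \<le> s" for s
    proof (cases "0 \<le> s")
      case True
      then show ?thesis
        using sector_scale[OF \<theta> w(1)] by blast
    next
      case False
      then have "norm w * \<bar>s\<bar> \<le> norm w * b"
        using that by (intro mult_left_mono) auto
      then have "norm (w * of_real s) \<le> norm w * b"
        by (simp only: norm_mult norm_of_real)
      then show ?thesis
        using small by simp
    qed
    have "norm (I - (\<Sum>n\<le>Suc N. of_real (bernoulli_poly n a / fact n) * w ^ n * D n 0)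
                 - w * (\<Sum>m. D 1 (w * of_real (real m + a)))) \<le> C' * norm w ^ Suc N"
      unfolding C'_def A_def
    proof (rule Euler_Maclaurin_ray[OF w(2) _ \<eta> C, where a = a, folded b_def])
      show "norm w * b \<le> 1"
        using small by simp
    next
      fix i :: nat and s :: real assume "- b \<le> s"
      then show "(D i has_field_derivative D (Suc i) (w * of_real s)) (at (w * of_real s))"
        using mem[of s] sector_T \<delta>(2) by (intro D) blast
    next
      fix s :: real assume "- b \<le> s"
      then show "norm (D (Suc (Suc N)) (w * of_real s)) \<le> C * (1 + norm w * \<bar>s\<bar>) powr (- 1 - \<eta>)"
        using bound[OF mem[of s]] by (simp add: norm_mult)
    next
      have "(\<lambda>m. F (w * of_real (real m)) - F 0) \<longlonglongrightarrow> F 0 + I - F 0"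
        unfolding I_def
        by (intro tendsto_diff tendsto_const decaying_primitive_ray_limit[OF \<theta> w \<epsilon> F_sector f])
      then show "(\<lambda>m. D 0 (w * of_real (real m))) \<longlonglongrightarrow> I"
        by (simp add: D_simps)
    next
      fix n
      obtain K' \<epsilon>' where "0 < \<epsilon>'" "0 \<le> K'"
        "\<And>z. z \<in> sector \<theta> \<Longrightarrow> norm (D (Suc n) z) \<le> K' * (1 + norm z) powr (- 1 - \<epsilon>')"
        using decay[of n] by blast
      then show "(\<lambda>m. D (Suc n) (w * of_real (real m))) \<longlonglongrightarrow> 0"
        using decay_tendsto_0[OF \<theta> w] by blast
    next
      show "summable (\<lambda>m. D 1 (w * of_real (real m + a)))"
        using summable[OF w] by (simp add: D_simps)
    qed
    \<comment> \<open>The term for \<open>n = 0\<close> vanishes because \<open>D 0 0 = 0\<close>.\<close>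
    moreover have "(\<Sum>n\<le>Suc N. of_real (bernoulli_poly n a / fact n) * w ^ n * D n 0) = w * (\<Sum>n\<le>N. c n * w ^ n)"
      unfolding lessThan_Suc_atMost[symmetric] sum.lessThan_Suc_shift[of _ "Suc N"] sum_distrib_left
      by (simp add: D_simps c_def mult_ac)
    ultimately have "norm (I - w * (\<Sum>n\<le>N. c n * w ^ n) - w * (\<Sum>m. f (w * of_real (real m + a)))) \<le> C' * norm w ^ Suc N"
      by (simp add: D_simps)
    moreover define Z where "Z = (\<Sum>m. f (w * of_real (real m + a))) - (1 / w * I - (\<Sum>n\<le>N. c n * w ^ n))"
    have "I - w * (\<Sum>n\<le>N. c n * w ^ n) - w * (\<Sum>m. f (w * of_real (real m + a))) = - (w * Z)"
      using w(2) by (simp add: Z_def algebra_simps)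
    ultimately have "norm w * norm Z \<le> norm w * (C' * norm w ^ N)"
      by (simp only: norm_mult norm_minus_cancel power_Suc mult.left_commute)
    then have "norm Z \<le> C' * norm w ^ N"
      by (rule mult_left_le_imp_le) (use w(2) in simp)
    \<comment> \<open>The remainder was estimated with one term more than the theorem has; that term is itself
        of the order \<open>w ^ N\<close>.\<close>
    then have "norm (Z - c N * w ^ N) \<le> C' * norm w ^ N + norm (c N * w ^ N)"
      by (intro order_trans[OF norm_triangle_ineq4] add_mono order_refl)
    also have "Z - c N * w ^ N = (\<Sum>m. f (w * of_real (real m + a))) - (1 / w * I - (\<Sum>n<N. c n * w ^ n))"
      by (simp add: Z_def lessThan_Suc_atMost[symmetric])
    finally show ?thesis
      by (simp only: norm_mult norm_power distrib_right)
  qed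
  have "(\<lambda>w. (\<Sum>m. f (w * of_real (real m + a))) - (1 / w * I - (\<Sum>n<N. c n * w ^ n)))
        \<in> O[at 0 within sector \<theta>](\<lambda>w. w ^ N)"
  proof (rule bigoI)
    show "\<forall>\<^sub>F w in at 0 within sector \<theta>.
        norm ((\<Sum>m. f (w * of_real (real m + a))) - (1 / w * I - (\<Sum>n<N. c n * w ^ n)))
        \<le> (C' + norm (c N)) * norm (w ^ N)"
      unfolding eventually_at
    proof (intro exI[of _ "min 1 \<delta> / b"] conjI ballI impI)
      show "0 < min 1 \<delta> / b"
        using \<delta> b by simp
      fix w assume "w \<in> sector \<theta>" "w \<noteq> 0 \<and> dist w 0 < min 1 \<delta> / b"
      then show "norm ((\<Sum>m. f (w * of_real (real m + a))) - (1 / w * I - (\<Sum>n<N. c n * w ^ n)))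
          \<le> (C' + norm (c N)) * norm (w ^ N)"
        using b by (intro estimate) (auto simp: pos_less_divide_eq)
    qed
  qed
  then show ?thesis
    using integrable summable by (simp add: I_def c_def)
qed

end
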